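(* Let $(U,\gamma)$ be a symmetric parallelism structure (i.e. $\gamma_a(b)=\gamma_b(a)$ for all $a,b$) with curvature field $\rho$. Then $\rho$ satisfies Bianchi's identity: for all $a,b,c,d\in\mathcal{V}(U)$, $$(\nabla_d^{+++-}\rho)(a,b,c)+(\nabla_a^{+++-}\rho)(b,d,c)+(\nabla_b^{+++-}\rho)(d,a,c)=0.$$
   Context: $M$ is an $n$-dimensional smooth manifold, $(U_o,\phi_o)$ a chart with coordinates $x^1,\dots,x^n$, and $U\subset U_o$ open. The canonical space $\mathcal{U}_o$ is an $n$-dimensional real vector space with basis $b_1,\dots,b_n$ and the Euclidean scalar product $b_\mu\cdot b_\nu=\delta_{\mu\nu}$. $\mathcal{V}(U)$ denotes the smooth maps $U\to\mathcal{U}_o$. For $a\in\mathcal V(U)$, $a\cdot\partial_o X=\sum_\mu(a\cdot b_\mu)\,\partial X/\partial x^\mu$ (componentwise). The Lie bracket is $[a,b]=a\cdot\partial_ob-b\cdot\partial_oa$. A parallelism structure $(U,\gamma)$ consists of $U$ and a connection field $\gamma$: a smooth map on $U$ with values bilinear maps $\mathcal{U}_o\times\mathcal{U}_o\to\mathcal{U}_o$; $\gamma_a(b)=\gamma(a,b)$, and ${}^\dagger$ is the Euclidean adjoint. On vector fields $b$: $\nabla_a^{+}b=a\cdot\partial_ob+\gamma_a(b)$ and $\nabla_a^{-}b=a\cdot\partial_ob-\gamma_a^{\dagger}(b)$. Curvature field: $\rho(a,b,c)=[\nabla_a^{+},\nabla_b^{+}]c-\nabla_{[a,b]}^{+}c$.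 Its covariant derivative $\nabla_d^{+++-}\rho$ is defined by: for all $a,b,c,w\in\mathcal{V}(U)$, $$(\nabla_d^{+++-}\rho)(a,b,c)\cdot w=d\cdot\partial_o(\rho(a,b,c)\cdot w)-\rho(\nabla_d^{+}a,b,c)\cdot w-\rho(a,\nabla_d^{+}b,c)\cdot w-\rho(a,b,\nabla_d^{+}c)\cdot w-\rho(a,b,c)\cdot\nabla_d^{-}w.$$ *)

theory Defs
  imports "HOL-Analysis.Analysis"
begin

section \<open>Smooth maps and smooth manifolds\<close>

text \<open>Meant for open \<open>S\<close> only: \<open>frechet_derivative\<close> is taken at \<open>x\<close> with respect to a full
  neighbourhood, so that \<open>frechet_derivative f (at x) i\<close> is the partial derivative in direction \<open>i\<close>.\<close>

primrec Ck_on :: "nat \<Rightarrow> ('a::euclidean_space \<Rightarrow> 'b::real_normed_vector) \<Rightarrow> 'a set \<Rightarrow> bool" where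
  "Ck_on 0 f S \<longleftrightarrow> continuous_on S f"
| "Ck_on (Suc k) f S \<longleftrightarrow>
     f differentiable_on S \<and> (\<forall>i\<in>Basis. Ck_on k (\<lambda>x. frechet_derivative f (at x) i) S)"

definition smooth_on :: "('a::euclidean_space \<Rightarrow> 'b::real_normed_vector) \<Rightarrow> 'a set \<Rightarrow> bool" where
  "smooth_on f S \<longleftrightarrow> (\<forall>k. Ck_on k f S)"

text \<open>A chart is a pair of its domain and its coordinate map; the values of the (total) coordinate
  map outside the domain are irrelevant.\<close>

type_synonym ('m, 'n) chart = "'m set \<times> ('m \<Rightarrow> real ^ 'n)"

definition chart_inv :: "('m, 'n) chart \<Rightarrow> real ^ 'n \<Rightarrow> 'm" where
  "chart_inv \<kappa> = inv_into (fst \<kappa>) (snd \<kappa>)"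

definition is_chart :: "('m::topological_space, 'n::finite) chart \<Rightarrow> bool" where
  "is_chart \<kappa> \<longleftrightarrow> open (fst \<kappa>) \<and> open (snd \<kappa> ` fst \<kappa>) \<and>
     homeomorphism (fst \<kappa>) (snd \<kappa> ` fst \<kappa>) (snd \<kappa>) (chart_inv \<kappa>)"

definition compatible :: "('m, 'n::finite) chart \<Rightarrow> ('m, 'n) chart \<Rightarrow> bool" where
  "compatible \<kappa> \<kappa>' \<longleftrightarrow>
     smooth_on (snd \<kappa>' \<circ> chart_inv \<kappa>) (snd \<kappa> ` (fst \<kappa> \<inter> fst \<kappa>')) \<and>
     smooth_on (snd \<kappa> \<circ> chart_inv \<kappa>') (snd \<kappa>' ` (fst \<kappa> \<inter> fst \<kappa>'))"

text \<open>The underlying space of the manifold is the whole type \<open>'m\<close>, its dimension is \<open>CARD('n)\<close>, and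
  \<open>A\<close> is its maximal smooth atlas.\<close>

definition smooth_manifold ::
    "('m::{t2_space, second_countable_topology}, 'n::finite) chart set \<Rightarrow> bool" where
  "smooth_manifold A \<longleftrightarrow>
     (\<forall>\<kappa>\<in>A. is_chart \<kappa>) \<and> (\<Union>\<kappa>\<in>A. fst \<kappa>) = UNIV \<and>
     (\<forall>\<kappa>\<in>A. \<forall>\<kappa>'\<in>A. compatible \<kappa> \<kappa>') \<and>
     (\<forall>\<kappa>. is_chart \<kappa> \<and> (\<forall>\<kappa>'\<in>A. compatible \<kappa> \<kappa>') \<longrightarrow> \<kappa> \<in> A)"

definition smooth_map_on ::
    "('m, 'n::finite) chart set \<Rightarrow> 'm set \<Rightarrow> ('m \<Rightarrow> 'b::real_normed_vector) \<Rightarrow> bool" where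
  "smooth_map_on A U f \<longleftrightarrow> (\<forall>\<kappa>\<in>A. smooth_on (f \<circ> chart_inv \<kappa>) (snd \<kappa> ` (U \<inter> fst \<kappa>)))"


section \<open>Fields on a chart domain\<close>

text \<open>The canonical space is \<open>real ^ 'n\<close> with its inner product and basis vectors
  \<open>b\<^sub>\<mu> = axis \<mu> 1\<close>. Fields are total functions on \<open>'m\<close>; only their values on \<open>U\<close> matter.\<close>

definition vector_fields ::
    "('m, 'n::finite) chart set \<Rightarrow> 'm set \<Rightarrow> ('m \<Rightarrow> real ^ 'n) set" where
  "vector_fields A U = {a. smooth_map_on A U a}"

definition partial_deriv ::
    "('m, 'n::finite) chart \<Rightarrow> 'n \<Rightarrow> ('m \<Rightarrow> 'b::real_normed_vector) \<Rightarrow> 'm \<Rightarrow> 'b" where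
  "partial_deriv \<kappa> \<mu> X p =
     frechet_derivative (X \<circ> chart_inv \<kappa>) (at (snd \<kappa> p)) (axis \<mu> 1)"

definition dir_deriv ::
    "('m, 'n::finite) chart \<Rightarrow> ('m \<Rightarrow> real ^ 'n) \<Rightarrow> ('m \<Rightarrow> 'b::real_normed_vector) \<Rightarrow> 'm \<Rightarrow> 'b" where
  "dir_deriv \<kappa> a X p = (\<Sum>\<mu>\<in>UNIV. (a p \<bullet> axis \<mu> 1) *\<^sub>R partial_deriv \<kappa> \<mu> X p)"

definition lie_bracket ::
    "('m, 'n::finite) chart \<Rightarrow> ('m \<Rightarrow> real ^ 'n) \<Rightarrow> ('m \<Rightarrow> real ^ 'n) \<Rightarrow> 'm \<Rightarrow> real ^ 'n" where
  "lie_bracket \<kappa> a b p = dir_deriv \<kappa> a b p - dir_deriv \<kappa> b a p"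


section \<open>Parallelism structures\<close>

text \<open>The type \<open>('m, 'n) connection\<close> encodes fields of bilinear maps in curried form, as bounded linear
  maps into bounded linear maps; boundedness is automatic in finite dimension, and the operator norm
  gives smoothness its usual meaning.\<close>

type_synonym ('m, 'n) connection =
  "'m \<Rightarrow> (real ^ 'n) \<Rightarrow>\<^sub>L (real ^ 'n) \<Rightarrow>\<^sub>L (real ^ 'n)"

definition parallelism_structure ::
    "('m::{t2_space, second_countable_topology}, 'n::finite) chart set \<Rightarrow> ('m, 'n) chart \<Rightarrow>
      'm set \<Rightarrow> ('m, 'n) connection \<Rightarrow> bool" where
  "parallelism_structure A \<kappa> U \<gamma> \<longleftrightarrow>
     smooth_manifold A \<and> \<kappa> \<in> A \<and> open U \<and> U \<subseteq> fst \<kappa> \<and> smooth_map_on A U \<gamma>"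

definition symmetric_connection :: "'m set \<Rightarrow> ('m, 'n::finite) connection \<Rightarrow> bool" where
  "symmetric_connection U \<gamma> \<longleftrightarrow>
     (\<forall>p\<in>U. \<forall>u v. blinfun_apply (blinfun_apply (\<gamma> p) u) v = blinfun_apply (blinfun_apply (\<gamma> p) v) u)"

definition cov_plus ::
    "('m, 'n::finite) chart \<Rightarrow> ('m, 'n) connection \<Rightarrow>
      ('m \<Rightarrow> real ^ 'n) \<Rightarrow> ('m \<Rightarrow> real ^ 'n) \<Rightarrow> 'm \<Rightarrow> real ^ 'n" where
  "cov_plus \<kappa> \<gamma> a b p = dir_deriv \<kappa> a b p + blinfun_apply (blinfun_apply (\<gamma> p) (a p)) (b p)"

definition cov_minus ::
    "('m, 'n::finite) chart \<Rightarrow> ('m, 'n) connection \<Rightarrow>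
      ('m \<Rightarrow> real ^ 'n) \<Rightarrow> ('m \<Rightarrow> real ^ 'n) \<Rightarrow> 'm \<Rightarrow> real ^ 'n" where
  "cov_minus \<kappa> \<gamma> a b p =
     dir_deriv \<kappa> a b p - adjoint (blinfun_apply (blinfun_apply (\<gamma> p) (a p))) (b p)"

definition curvature ::
    "('m, 'n::finite) chart \<Rightarrow> ('m, 'n) connection \<Rightarrow>
      ('m \<Rightarrow> real ^ 'n) \<Rightarrow> ('m \<Rightarrow> real ^ 'n) \<Rightarrow> ('m \<Rightarrow> real ^ 'n) \<Rightarrow> 'm \<Rightarrow> real ^ 'n" where
  "curvature \<kappa> \<gamma> a b c p =
     cov_plus \<kappa> \<gamma> a (cov_plus \<kappa> \<gamma> b c) p - cov_plus \<kappa> \<gamma> b (cov_plus \<kappa> \<gamma> a c) p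
     - cov_plus \<kappa> \<gamma> (lie_bracket \<kappa> a b) c p"

text \<open>The covariant derivative of the curvature field is given implicitly by its inner products
  with all \<open>w\<close>. For \<open>p \<in> U\<close> at most one vector has the required inner products, since the constant
  fields are among the \<open>w\<close>; one exists because the right-hand side depends on \<open>w\<close> only through
  \<open>w p\<close>, linearly.\<close>

definition cov_curvature ::
    "('m, 'n::finite) chart set \<Rightarrow> ('m, 'n) chart \<Rightarrow> 'm set \<Rightarrow> ('m, 'n) connection \<Rightarrow>
      ('m \<Rightarrow> real ^ 'n) \<Rightarrow> ('m \<Rightarrow> real ^ 'n) \<Rightarrow> ('m \<Rightarrow> real ^ 'n) \<Rightarrow> ('m \<Rightarrow> real ^ 'n) \<Rightarrow>
      'm \<Rightarrow> real ^ 'n" where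
  "cov_curvature A \<kappa> U \<gamma> d a b c p =
     (THE v. \<forall>w\<in>vector_fields A U.
        v \<bullet> w p =
          dir_deriv \<kappa> d (\<lambda>q. curvature \<kappa> \<gamma> a b c q \<bullet> w q) p
          - curvature \<kappa> \<gamma> (cov_plus \<kappa> \<gamma> d a) b c p \<bullet> w p
          - curvature \<kappa> \<gamma> a (cov_plus \<kappa> \<gamma> d b) c p \<bullet> w p
          - curvature \<kappa> \<gamma> a b (cov_plus \<kappa> \<gamma> d c) p \<bullet> w p
          - curvature \<kappa> \<gamma> a b c p \<bullet> cov_minus \<kappa> \<gamma> d w p)"

end

theory Submission
  imports Defs
begin

text \<open>The adjoint in \<open>cov_minus\<close> makes the implicit definition say
  \<open>(\<nabla>\<^sub>d \<rho>)(a,b,c) = \<nabla>\<^sub>d(\<rho>(a,b,c)) - \<rho>(\<nabla>\<^sub>d a,b,c) - \<rho>(a,\<nabla>\<^sub>d b,c) - \<rho>(a,b,\<nabla>\<^sub>d c)\<close>, with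
  \<open>\<nabla> = \<nabla>\<^sup>+\<close> everywhere. Since \<open>\<rho>\<close> is additive and alternating in its first two arguments and
  \<open>\<nabla>\<^sub>d a - \<nabla>\<^sub>a d = [d,a]\<close>, the cyclic sum is that of
  \<open>[\<nabla>\<^sub>d, \<rho>(a,b)] c - \<rho>([d,a],b) c\<close>, which vanishes by the Jacobi identities for operator
  commutators and for the Lie bracket. The latter is where symmetry of second derivatives enters.\<close>

section \<open>Symmetry of second derivatives\<close>

text \<open>The mean value theorem is applied twice: along \<open>u\<close> to the increment in
  direction \<open>v\<close>, then along \<open>v\<close> to the derivative in direction
  \<open>u\<close>. The second difference is symmetric in \<open>u\<close> and \<open>v\<close>, so
  exchanging them expresses the same number by the other mixed derivative.\<close>

lemma mixed_difference_mvt: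
  fixes f :: "'a::real_normed_vector \<Rightarrow> real"
  assumes h: "0 < h"
    and S: "\<And>s t. 0 \<le> s \<Longrightarrow> s \<le> h \<Longrightarrow> 0 \<le> t \<Longrightarrow> t \<le> h \<Longrightarrow> x + s *\<^sub>R u + t *\<^sub>R v \<in> S"
    and f: "\<And>y. y \<in> S \<Longrightarrow> (f has_derivative f' y) (at y)"
    and f': "\<And>y. y \<in> S \<Longrightarrow> ((\<lambda>y. f' y u) has_derivative f'' y) (at y)"
  obtains s t where "0 < s" "s < h" "0 < t" "t < h"
    "f (x + h *\<^sub>R u + h *\<^sub>R v) - f (x + h *\<^sub>R u) - f (x + h *\<^sub>R v) + f x
      = h\<^sup>2 * f'' (x + s *\<^sub>R u + t *\<^sub>R v) v"
proof -
  have lin: "linear (f' y)" if "y \<in> S" for y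
    using f[OF that] by (rule has_derivative_linear)
  have lin': "linear (f'' y)" if "y \<in> S" for y
    using f'[OF that] by (rule has_derivative_linear)
  have line_u: "((\<lambda>s. f (x + s *\<^sub>R u + t *\<^sub>R v)) has_real_derivative f' (x + s *\<^sub>R u + t *\<^sub>R v) u) (at s)"
    if "0 \<le> s" "s \<le> h" "0 \<le> t" "t \<le> h" for s t
  proof -
    have "((\<lambda>s. x + s *\<^sub>R u + t *\<^sub>R v) has_derivative (\<lambda>k. k *\<^sub>R u)) (at s)"
      by (auto intro!: derivative_eq_intros)
    from has_derivative_compose[OF this f[OF S[OF that]]]
    show ?thesis
      using linear_cmul[OF lin[OF S[OF that]]]
      by (simp add: has_field_derivative_def mult.commute[of _ "f' _ u"])
  qed
  have line_v: "((\<lambda>t. f' (x + s *\<^sub>R u + t *\<^sub>R v) u) has_real_derivative f'' (x + s *\<^sub>R u + t *\<^sub>R v) v) (at t)"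
    if "0 \<le> s" "s \<le> h" "0 \<le> t" "t \<le> h" for s t
  proof -
    have "((\<lambda>t. x + s *\<^sub>R u + t *\<^sub>R v) has_derivative (\<lambda>k. k *\<^sub>R v)) (at t)"
      by (auto intro!: derivative_eq_intros)
    from has_derivative_compose[OF this f'[OF S[OF that]]]
    show ?thesis
      using linear_cmul[OF lin'[OF S[OF that]]]
      by (simp add: has_field_derivative_def mult.commute[of _ "f'' _ v"])
  qed
  \<comment> \<open>The summand \<open>0 *\<^sub>R v\<close> is kept so that both terms are
    instances of \<open>line_u\<close>, with \<open>t = h\<close> and \<open>t = 0\<close>.\<close>
  define g where "g s = f (x + s *\<^sub>R u + h *\<^sub>R v) - f (x + s *\<^sub>R u + 0 *\<^sub>R v)" for s
  have "\<exists>s>0. s < h \<and> g h - g 0 =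
      (h - 0) * (f' (x + s *\<^sub>R u + h *\<^sub>R v) u - f' (x + s *\<^sub>R u + 0 *\<^sub>R v) u)"
    unfolding g_def using h by (intro MVT2 DERIV_diff line_u) auto
  then obtain s where s: "0 < s" "s < h" and
    gs: "g h - g 0 = h * (f' (x + s *\<^sub>R u + h *\<^sub>R v) u - f' (x + s *\<^sub>R u + 0 *\<^sub>R v) u)"
    by auto
  have "\<exists>t>0. t < h \<and> f' (x + s *\<^sub>R u + h *\<^sub>R v) u - f' (x + s *\<^sub>R u + 0 *\<^sub>R v) u =
      (h - 0) * f'' (x + s *\<^sub>R u + t *\<^sub>R v) v"
    using h s by (intro MVT2 line_v) auto
  then obtain t where t: "0 < t" "t < h" and
    ft: "f' (x + s *\<^sub>R u + h *\<^sub>R v) u - f' (x + s *\<^sub>R u + 0 *\<^sub>R v) u = h * f'' (x + s *\<^sub>R u + t *\<^sub>R v) v"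
    by auto
  show ?thesis
    using that[OF s t] gs unfolding ft by (simp add: g_def power2_eq_square)
qed

text \<open>Schwarz's theorem: the second difference equals \<open>h\<^sup>2\<close> times either
  mixed derivative, each at some point close to \<open>x\<close>, so continuity forces the two
  values at \<open>x\<close> to agree.\<close>

lemma second_derivative_symmetric_real:
  fixes f :: "'a::real_normed_vector \<Rightarrow> real"
  assumes S: "open S" "x \<in> S"
    and f: "\<And>y. y \<in> S \<Longrightarrow> (f has_derivative f' y) (at y)"
    and fu: "\<And>y. y \<in> S \<Longrightarrow> ((\<lambda>y. f' y u) has_derivative fu y) (at y)"
    and fv: "\<And>y. y \<in> S \<Longrightarrow> ((\<lambda>y. f' y v) has_derivative fv y) (at y)"
    and cont: "continuous_on S (\<lambda>y. fu y v)" "continuous_on S (\<lambda>y. fv y u)"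
  shows "fu x v = fv x u"
proof (rule ccontr)
  assume "fu x v \<noteq> fv x u"
  \<comment> \<open>Half the gap: no number is closer than \<open>e\<close> to both values.\<close>
  define e where "e = \<bar>fu x v - fv x u\<bar> / 2"
  have e: "e > 0" using \<open>fu x v \<noteq> fv x u\<close> by (simp add: e_def)
  have "isCont (\<lambda>y. fu y v) x" "isCont (\<lambda>y. fv y u) x"
    using cont S by (auto simp: continuous_on_eq_continuous_at)
  then obtain d1 d2 where d1: "d1 > 0" "\<And>y. dist y x < d1 \<Longrightarrow> dist (fu y v) (fu x v) < e"
    and d2: "d2 > 0" "\<And>y. dist y x < d2 \<Longrightarrow> dist (fv y u) (fv x u) < e"
    using e unfolding continuous_at_eps_delta by metis
  obtain d3 where d3: "d3 > 0" "ball x d3 \<subseteq> S" using S open_contains_ball by blast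
  define d where "d = min d1 (min d2 d3)"
  have d: "d > 0" using d1 d2 d3 by (simp add: d_def)
  \<comment> \<open>The summand 1 keeps the denominator positive even for \<open>u = v = 0\<close>;
    the factor 2 bounds every displacement by \<open>d / 2\<close>, hence strictly below
    \<open>d\<close>.\<close>
  define h where "h = d / (2 * (norm u + norm v + 1))"
  have n: "norm u + norm v + 1 > 0"
    by (smt (verit) norm_ge_zero)
  have half_cancel: "d / (2 * k) * k = d / 2" if "k > 0" for k :: real
    using that by simp
  have h: "h > 0" using d n by (simp add: h_def)
  have near: "dist (x + s *\<^sub>R u + t *\<^sub>R v) x < d" if "0 \<le> s" "s \<le> h" "0 \<le> t" "t \<le> h" for s t
  proof -
    have "dist (x + s *\<^sub>R u + t *\<^sub>R v) x \<le> norm (s *\<^sub>R u) + norm (t *\<^sub>R v)"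
      using norm_triangle_ineq[of "s *\<^sub>R u" "t *\<^sub>R v"] by (simp add: dist_norm)
    also have "\<dots> \<le> h * norm u + h * norm v"
      using that by (intro add_mono) (auto intro: mult_right_mono)
    also have "\<dots> \<le> h * (norm u + norm v + 1)" using h by (simp add: algebra_simps)
    also have "\<dots> = d / 2" using half_cancel[OF n] by (simp only: h_def)
    finally show ?thesis using d by simp
  qed
  have inS: "x + s *\<^sub>R u + t *\<^sub>R v \<in> S" if "0 \<le> s" "s \<le> h" "0 \<le> t" "t \<le> h" for s t
    using near[OF that] d3 by (auto simp: d_def dist_commute mem_ball)
  obtain s t where st: "0 < s" "s < h" "0 < t" "t < h" and
    eq1: "f (x + h *\<^sub>R u + h *\<^sub>R v) - f (x + h *\<^sub>R u) - f (x + h *\<^sub>R v) + f x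
      = h\<^sup>2 * fu (x + s *\<^sub>R u + t *\<^sub>R v) v"
    using mixed_difference_mvt[OF h inS f fu] by blast
  have inS': "x + s *\<^sub>R v + t *\<^sub>R u \<in> S" if "0 \<le> s" "s \<le> h" "0 \<le> t" "t \<le> h" for s t
    using inS[OF that(3,4,1,2)] by (simp add: algebra_simps)
  obtain s' t' where st': "0 < s'" "s' < h" "0 < t'" "t' < h" and
    eq2: "f (x + h *\<^sub>R v + h *\<^sub>R u) - f (x + h *\<^sub>R v) - f (x + h *\<^sub>R u) + f x
      = h\<^sup>2 * fv (x + s' *\<^sub>R v + t' *\<^sub>R u) u"
    using mixed_difference_mvt[OF h inS' f fv] by blast
  have "h\<^sup>2 * fu (x + s *\<^sub>R u + t *\<^sub>R v) v = h\<^sup>2 * fv (x + s' *\<^sub>R v + t' *\<^sub>R u) u"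
    using eq1 eq2 by (simp add: algebra_simps)
  then have eq: "fu (x + s *\<^sub>R u + t *\<^sub>R v) v = fv (x + s' *\<^sub>R v + t' *\<^sub>R u) u"
    using h by simp
  have "dist (fu (x + s *\<^sub>R u + t *\<^sub>R v) v) (fu x v) < e"
    using near[of s t] st by (intro d1) (auto simp: d_def)
  moreover have "dist (fv (x + s' *\<^sub>R v + t' *\<^sub>R u) u) (fv x u) < e"
    using near[of t' s'] st' by (intro d2) (auto simp: d_def algebra_simps)
  ultimately show False
    unfolding eq e_def dist_real_def by (smt (verit) field_sum_of_halves)
qed

lemma second_derivative_symmetric:
  fixes f :: "'a::real_normed_vector \<Rightarrow> 'b::euclidean_space"
  assumes S: "open S" "x \<in> S"
    and f: "\<And>y. y \<in> S \<Longrightarrow> (f has_derivative f' y) (at y)"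
    and fu: "\<And>y. y \<in> S \<Longrightarrow> ((\<lambda>y. f' y u) has_derivative fu y) (at y)"
    and fv: "\<And>y. y \<in> S \<Longrightarrow> ((\<lambda>y. f' y v) has_derivative fv y) (at y)"
    and cont: "continuous_on S (\<lambda>y. fu y v)" "continuous_on S (\<lambda>y. fv y u)"
  shows "fu x v = fv x u"
proof (rule euclidean_eqI)
  fix k :: 'b assume "k \<in> Basis"
  show "fu x v \<bullet> k = fv x u \<bullet> k"
    by (rule second_derivative_symmetric_real[where f = "\<lambda>y. f y \<bullet> k" and S = S
          and f' = "\<lambda>y h. f' y h \<bullet> k" and fu = "\<lambda>y h. fu y h \<bullet> k" and fv = "\<lambda>y h. fv y h \<bullet> k"])
       (intro S has_derivative_inner_left f fu fv continuous_on_inner cont continuous_on_const; assumption)+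
qed


section \<open>Closure properties of smooth maps\<close>

lemma Ck_on_SucD: "Ck_on (Suc k) f S \<Longrightarrow> Ck_on k f S"
proof (induction k arbitrary: f)
  case 0
  then show ?case by (simp add: differentiable_imp_continuous_on)
next
  case (Suc k)
  then show ?case by (metis Ck_on.simps(2))
qed

text \<open>From right to left, the levels \<open>Suc k\<close> hold by definition, and
  \<open>Ck_on_SucD\<close> brings them down to every level \<open>k\<close>.\<close>

lemma smooth_on_iff:
  "smooth_on f S \<longleftrightarrow>
     f differentiable_on S \<and> (\<forall>i\<in>Basis. smooth_on (\<lambda>x. frechet_derivative f (at x) i) S)"
  unfolding smooth_on_def by (metis Ck_on.simps(2) Ck_on_SucD)

lemma smooth_on_differentiable_at:
  assumes "open S" "smooth_on f S" "x \<in> S"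
  shows "f differentiable at x"
  using assms smooth_on_iff differentiable_on_eq_differentiable_at by blast

text \<open>Since \<open>S\<close> is open, agreement on \<open>S\<close> gives equal derivatives at
  its points, whatever happens outside. Both functions are arbitrary in the induction because it
  passes to partial derivatives.\<close>

lemma Ck_on_cong:
  assumes "open S" "Ck_on k f S" "\<And>x. x \<in> S \<Longrightarrow> f x = g x"
  shows "Ck_on k g S"
  using assms(2,3)
proof (induction k arbitrary: f g)
  case 0
  then show ?case using continuous_on_cong[of S S f g] by simp
next
  case (Suc k)
  have fd: "f differentiable at x" if "x \<in> S" for x
    using Suc.prems(1) that assms(1) by (simp add: differentiable_on_eq_differentiable_at)
  have eq: "frechet_derivative f (at x) = frechet_derivative g (at x)" if "x \<in> S" for x
    using frechet_derivative_transform_within_open[OF fd[OF that] assms(1) that Suc.prems(2)] .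
  have "(g has_derivative frechet_derivative f (at x)) (at x)" if "x \<in> S" for x
    using has_derivative_transform_within_open[of f "frechet_derivative f (at x)" x UNIV S g]
      fd[OF that] Suc.prems(2) assms(1) that by (simp add: frechet_derivative_works)
  then have "g differentiable_on S"
    using assms(1) unfolding differentiable_on_eq_differentiable_at[OF assms(1)] differentiable_def by blast
  moreover have "Ck_on k (\<lambda>x. frechet_derivative g (at x) i) S" if "i \<in> Basis" for i
  proof (rule Suc.IH)
    show "Ck_on k (\<lambda>x. frechet_derivative f (at x) i) S" using Suc.prems(1) that by simp
  qed (simp add: eq)
  ultimately show ?case by simp
qed

text \<open>By uniqueness of the derivative any family \<open>f'\<close> can stand in for
  \<open>frechet_derivative\<close>, so the closure proofs can use the standard differentiation
  rules.\<close>

lemma Ck_on_SucI: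
  assumes "open S" "\<And>x. x \<in> S \<Longrightarrow> (f has_derivative f' x) (at x)"
    and "\<And>i. i \<in> Basis \<Longrightarrow> Ck_on k (\<lambda>x. f' x i) S"
  shows "Ck_on (Suc k) f S"
proof -
  have "Ck_on k (\<lambda>x. frechet_derivative f (at x) i) S" if "i \<in> Basis" for i
    using frechet_derivative_at[OF assms(2)] by (intro Ck_on_cong[OF assms(1) assms(3)[OF that]]) simp
  then show ?thesis
    using assms(1,2) by (auto simp: differentiable_on_eq_differentiable_at differentiable_def)
qed

lemma smooth_on_cong:
  assumes "open S" "smooth_on f S" "\<And>x. x \<in> S \<Longrightarrow> f x = g x"
  shows "smooth_on g S"
  using assms Ck_on_cong unfolding smooth_on_def by blast

lemma Ck_on_const: "Ck_on k (\<lambda>x. c) S"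
  by (induction k arbitrary: c) auto

lemma smooth_on_const: "smooth_on (\<lambda>x. c) S"
  by (simp add: smooth_on_def Ck_on_const)

lemma Ck_on_add:
  assumes S: "open S" and "Ck_on k f S" "Ck_on k g S"
  shows "Ck_on k (\<lambda>x. f x + g x) S"
  using assms(2,3)
proof (induction k arbitrary: f g)
  case 0
  then show ?case by (simp add: continuous_on_add)
next
  case (Suc k)
  have d: "f differentiable at x" "g differentiable at x" if "x \<in> S" for x
    using Suc.prems that S by (simp_all add: differentiable_on_eq_differentiable_at)
  show ?case
  proof (rule Ck_on_SucI[OF S])
    show "((\<lambda>x. f x + g x) has_derivative
        (\<lambda>h. frechet_derivative f (at x) h + frechet_derivative g (at x) h)) (at x)" if "x \<in> S" for x
      using d[OF that] by (intro has_derivative_add) (simp_all add: frechet_derivative_works)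
    show "Ck_on k (\<lambda>x. frechet_derivative f (at x) i + frechet_derivative g (at x) i) S"
      if "i \<in> Basis" for i
      using Suc.prems that by (intro Suc.IH) auto
  qed
qed

lemma smooth_on_add:
  "open S \<Longrightarrow> smooth_on f S \<Longrightarrow> smooth_on g S \<Longrightarrow> smooth_on (\<lambda>x. f x + g x) S"
  by (simp add: smooth_on_def Ck_on_add)

lemma smooth_on_sum:
  assumes "open S" "finite I" "\<And>i. i \<in> I \<Longrightarrow> smooth_on (f i) S"
  shows "smooth_on (\<lambda>x. \<Sum>i\<in>I. f i x) S"
  using assms(2,3)
  by (induction I rule: finite_induct) (auto intro: smooth_on_add assms(1) simp: smooth_on_const)

text \<open>Induction on \<open>k\<close> by the Leibniz rule: each partial derivative is a sum of
  such products, with the undifferentiated factor lowered by \<open>Ck_on_SucD\<close>. Scaling,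
  inner products and application of bounded linear maps are instances.\<close>

lemma (in bounded_bilinear) Ck_on_prod:
  assumes S: "open S" and "Ck_on k f S" "Ck_on k g S"
  shows "Ck_on k (\<lambda>x. prod (f x) (g x)) S"
  using assms(2,3)
proof (induction k arbitrary: f g)
  case 0
  then show ?case by (simp add: continuous_on)
next
  case (Suc k)
  have d: "f differentiable at x" "g differentiable at x" if "x \<in> S" for x
    using Suc.prems that S by (simp_all add: differentiable_on_eq_differentiable_at)
  show ?case
  proof (rule Ck_on_SucI[OF S])
    show "((\<lambda>x. prod (f x) (g x)) has_derivative
        (\<lambda>h. prod (f x) (frechet_derivative g (at x) h) + prod (frechet_derivative f (at x) h) (g x))) (at x)"
      if "x \<in> S" for x
      using d[OF that] by (intro FDERIV) (simp_all add: frechet_derivative_works)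
    show "Ck_on k (\<lambda>x. prod (f x) (frechet_derivative g (at x) i) + prod (frechet_derivative f (at x) i) (g x)) S"
      if "i \<in> Basis" for i
      using Suc.prems that by (intro Ck_on_add S Suc.IH Ck_on_SucD[of k f] Ck_on_SucD[of k g]) auto
  qed
qed

lemma (in bounded_bilinear) smooth_on_prod:
  "open S \<Longrightarrow> smooth_on f S \<Longrightarrow> smooth_on g S \<Longrightarrow> smooth_on (\<lambda>x. prod (f x) (g x)) S"
  by (simp add: smooth_on_def Ck_on_prod)

lemma smooth_on_diff:
  assumes "open S" "smooth_on f S" "smooth_on g S"
  shows "smooth_on (\<lambda>x. f x - g x) S"
  using smooth_on_add[OF assms(1,2) bounded_bilinear.smooth_on_prod[OF bounded_bilinear_scaleR
        assms(1) smooth_on_const[of "-1"] assms(3)]] by simp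

text \<open>Turns the coordinate sum in \<open>dir_deriv\<close> into the full derivative applied to
  the direction.\<close>

lemma linear_axis_expansion:
  fixes f :: "real ^ 'n::finite \<Rightarrow> 'b::real_vector"
  assumes "linear f"
  shows "(\<Sum>\<mu>\<in>UNIV. (v \<bullet> axis \<mu> 1) *\<^sub>R f (axis \<mu> 1)) = f v"
proof -
  have "v = (\<Sum>\<mu>\<in>UNIV. (v \<bullet> axis \<mu> 1) *\<^sub>R axis \<mu> 1)"
    by (simp add: cart_eq_inner_axis[symmetric] basis_expansion scalar_mult_eq_scaleR[symmetric])
  then have "f v = f (\<Sum>\<mu>\<in>UNIV. (v \<bullet> axis \<mu> 1) *\<^sub>R axis \<mu> 1)" by simp
  then show ?thesis using assms by (simp add: linear_sum linear_cmul)
qed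


section \<open>Calculus of fields on a chart domain\<close>

locale chart_region =
  fixes \<kappa> :: "('m::topological_space, 'n::finite) chart" and U :: "'m set"
  assumes chart: "is_chart \<kappa>" and open_U: "open U" and U_subset: "U \<subseteq> fst \<kappa>"
begin

abbreviation coords :: "(real ^ 'n) set" where
  "coords \<equiv> snd \<kappa> ` U"

text \<open>Smoothness in the single chart \<open>\<kappa>\<close>, the one in which
  \<open>partial_deriv\<close> differentiates.\<close>

definition smooth_field :: "('m \<Rightarrow> 'b::real_normed_vector) \<Rightarrow> bool" where
  "smooth_field X \<longleftrightarrow> smooth_on (\<lambda>x. X (chart_inv \<kappa> x)) coords"

text \<open>The homeomorphism carries \<open>U\<close> to a relatively open part of the chart's
  image, which is itself open.\<close>

lemma open_coords: "open coords"
proof -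
  have hom: "homeomorphism (fst \<kappa>) (snd \<kappa> ` fst \<kappa>) (snd \<kappa>) (chart_inv \<kappa>)"
    and op: "open (snd \<kappa> ` fst \<kappa>)" using chart by (auto simp: is_chart_def)
  have "openin (top_of_set (fst \<kappa>)) U"
    using open_U U_subset by (simp add: open_subset)
  from homeomorphism_imp_open_map[OF hom this] op show ?thesis
    by (rule openin_open_trans)
qed

lemma chart_inv_coord [simp]: "p \<in> U \<Longrightarrow> chart_inv \<kappa> (snd \<kappa> p) = p"
  using chart U_subset by (auto simp: is_chart_def homeomorphism_def)

lemma smooth_fieldD:
  assumes "smooth_field X" "p \<in> U"
  shows "(\<lambda>x. X (chart_inv \<kappa> x)) differentiable at (snd \<kappa> p)"
  using assms smooth_on_differentiable_at[OF open_coords] by (auto simp: smooth_field_def)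

lemma smooth_field_add: "smooth_field X \<Longrightarrow> smooth_field Y \<Longrightarrow> smooth_field (\<lambda>q. X q + Y q)"
  by (simp add: smooth_field_def smooth_on_add open_coords)

lemma smooth_field_diff: "smooth_field X \<Longrightarrow> smooth_field Y \<Longrightarrow> smooth_field (\<lambda>q. X q - Y q)"
  by (simp add: smooth_field_def smooth_on_diff open_coords)

text \<open>On \<open>coords\<close> the maps \<open>chart_inv \<kappa>\<close> and
  \<open>snd \<kappa>\<close> cancel, so the coordinate expression is an ordinary partial
  derivative, covered by \<open>smooth_on_iff\<close>.\<close>

lemma smooth_field_partial_deriv: "smooth_field X \<Longrightarrow> smooth_field (partial_deriv \<kappa> \<mu> X)"
  unfolding smooth_field_def
  by (rule smooth_on_cong[OF open_coords, of "\<lambda>x. frechet_derivative (\<lambda>x. X (chart_inv \<kappa> x)) (at x) (axis \<mu> 1)"])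
     (auto simp: partial_deriv_def comp_def smooth_on_iff[of "\<lambda>x. X (chart_inv \<kappa> x)"] axis_in_Basis_iff)

lemma smooth_field_dir_deriv:
  assumes "smooth_field a" "smooth_field X"
  shows "smooth_field (dir_deriv \<kappa> a X)"
  using assms smooth_field_partial_deriv[OF assms(2)]
  unfolding smooth_field_def dir_deriv_def
  by (intro smooth_on_sum open_coords bounded_bilinear.smooth_on_prod[OF bounded_bilinear_scaleR]
      bounded_bilinear.smooth_on_prod[OF bounded_bilinear_inner] smooth_on_const) auto

lemma dir_deriv_eq:
  assumes "smooth_field X" "p \<in> U"
  shows "dir_deriv \<kappa> a X p = frechet_derivative (\<lambda>x. X (chart_inv \<kappa> x)) (at (snd \<kappa> p)) (a p)"
  using linear_axis_expansion[OF linear_frechet_derivative[OF smooth_fieldD[OF assms]]]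
  by (simp add: dir_deriv_def partial_deriv_def comp_def)

text \<open>Any known derivative of the coordinate expression may be used, so standard rules yield
  those for \<open>dir_deriv\<close>.\<close>

lemma dir_deriv_eqI:
  assumes "smooth_field X" "p \<in> U" "((\<lambda>x. X (chart_inv \<kappa> x)) has_derivative D) (at (snd \<kappa> p))"
  shows "dir_deriv \<kappa> a X p = D (a p)"
  using dir_deriv_eq[OF assms(1,2)] frechet_derivative_at[OF assms(3)] by simp

lemma smooth_field_has_derivative:
  assumes "smooth_field X" "p \<in> U"
  shows "((\<lambda>x. X (chart_inv \<kappa> x)) has_derivative
    frechet_derivative (\<lambda>x. X (chart_inv \<kappa> x)) (at (snd \<kappa> p))) (at (snd \<kappa> p))"
  using smooth_fieldD[OF assms] by (simp add: frechet_derivative_works)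

lemma dir_deriv_diff_left:
  "dir_deriv \<kappa> (\<lambda>q. a q - b q) X p = dir_deriv \<kappa> a X p - dir_deriv \<kappa> b X p"
  by (simp add: dir_deriv_def inner_diff_left scaleR_left_diff_distrib sum_subtractf)

lemma dir_deriv_diff_right:
  assumes "smooth_field X" "smooth_field Y" "p \<in> U"
  shows "dir_deriv \<kappa> a (\<lambda>q. X q - Y q) p = dir_deriv \<kappa> a X p - dir_deriv \<kappa> a Y p"
  using dir_deriv_eqI[OF smooth_field_diff[OF assms(1,2)] assms(3) has_derivative_diff[OF
        smooth_field_has_derivative[OF assms(1,3)] smooth_field_has_derivative[OF assms(2,3)]]]
  by (simp add: dir_deriv_eq assms)

lemma dir_deriv_inner:
  assumes "smooth_field X" "smooth_field Y" "p \<in> U"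
  shows "dir_deriv \<kappa> a (\<lambda>q. X q \<bullet> Y q) p = dir_deriv \<kappa> a X p \<bullet> Y p + X p \<bullet> dir_deriv \<kappa> a Y p"
proof -
  have "smooth_field (\<lambda>q. X q \<bullet> Y q)"
    using assms unfolding smooth_field_def
    by (intro bounded_bilinear.smooth_on_prod[OF bounded_bilinear_inner] open_coords)
  from dir_deriv_eqI[OF this assms(3) has_derivative_inner[OF
        smooth_field_has_derivative[OF assms(1,3)] smooth_field_has_derivative[OF assms(2,3)]]]
  show ?thesis using assms by (simp add: dir_deriv_eq)
qed

text \<open>\<open>X\<close> is differentiated and has to agree with \<open>Y\<close> on the whole
  open set, whereas the direction enters through its value at \<open>p\<close> only.\<close>

lemma dir_deriv_cong:
  assumes "smooth_field X" "\<And>q. q \<in> U \<Longrightarrow> X q = Y q" "a p = b p" "p \<in> U"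
  shows "dir_deriv \<kappa> a X p = dir_deriv \<kappa> b Y p"
proof -
  have Y: "smooth_field Y"
    unfolding smooth_field_def
  proof (rule smooth_on_cong[OF open_coords])
    show "smooth_on (\<lambda>x. X (chart_inv \<kappa> x)) coords" using assms(1) by (simp add: smooth_field_def)
  qed (use assms(2) in auto)
  have "frechet_derivative (\<lambda>x. X (chart_inv \<kappa> x)) (at (snd \<kappa> p)) =
      frechet_derivative (\<lambda>x. Y (chart_inv \<kappa> x)) (at (snd \<kappa> p))"
    using assms by (intro frechet_derivative_transform_within_open[OF smooth_fieldD open_coords]) auto
  then show ?thesis using assms Y by (simp add: dir_deriv_eq)
qed

text \<open>Schwarz's theorem for the coordinate expression \<open>f\<close> of
  \<open>X\<close>.\<close>

lemma partial_deriv_commute: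
  fixes X :: "'m \<Rightarrow> 'b::euclidean_space"
  assumes X: "smooth_field X" and p: "p \<in> U"
  shows "partial_deriv \<kappa> \<mu> (partial_deriv \<kappa> \<nu> X) p = partial_deriv \<kappa> \<nu> (partial_deriv \<kappa> \<mu> X) p"
proof -
  define f where "f = (\<lambda>x. X (chart_inv \<kappa> x))"
  define f' where "f' y = frechet_derivative f (at y)" for y
  have f: "smooth_on f coords" using X by (simp add: smooth_field_def f_def)
  have f': "smooth_on (\<lambda>y. f' y (axis \<rho> 1)) coords" for \<rho>
    using f unfolding f'_def by (subst (asm) smooth_on_iff) (auto simp: axis_in_Basis_iff)
  have f'': "continuous_on coords (\<lambda>y. frechet_derivative (\<lambda>y. f' y (axis \<rho> 1)) (at y) (axis \<sigma> 1))" for \<rho> \<sigma>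
    using f'[of \<rho>]
    by (subst (asm) smooth_on_iff) (auto simp: smooth_on_def axis_in_Basis_iff dest!: spec[of _ 0])
  have sym: "frechet_derivative (\<lambda>y. f' y (axis \<nu> 1)) (at (snd \<kappa> p)) (axis \<mu> 1) =
      frechet_derivative (\<lambda>y. f' y (axis \<mu> 1)) (at (snd \<kappa> p)) (axis \<nu> 1)"
  proof (rule second_derivative_symmetric[where f = f and f' = f' and S = coords
        and fu = "\<lambda>y. frechet_derivative (\<lambda>y. f' y (axis \<nu> 1)) (at y)"
        and fv = "\<lambda>y. frechet_derivative (\<lambda>y. f' y (axis \<mu> 1)) (at y)"])
    show "(f has_derivative f' y) (at y)" if "y \<in> coords" for y
      using smooth_on_differentiable_at[OF open_coords f that] by (simp add: f'_def frechet_derivative_works)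
    show "((\<lambda>y. f' y (axis \<nu> 1)) has_derivative frechet_derivative (\<lambda>y. f' y (axis \<nu> 1)) (at y)) (at y)"
      "((\<lambda>y. f' y (axis \<mu> 1)) has_derivative frechet_derivative (\<lambda>y. f' y (axis \<mu> 1)) (at y)) (at y)"
      if "y \<in> coords" for y
      using smooth_on_differentiable_at[OF open_coords f' that] by (simp_all add: frechet_derivative_works)
  qed (use p open_coords f'' in auto)
  \<comment> \<open>The outer \<open>partial_deriv\<close> differentiates a function known to agree
    with the derivative of \<open>f\<close> on \<open>coords\<close>; openness makes their
    derivatives equal.\<close>
  have "frechet_derivative (\<lambda>x. partial_deriv \<kappa> \<rho> X (chart_inv \<kappa> x)) (at (snd \<kappa> p)) =
      frechet_derivative (\<lambda>y. f' y (axis \<rho> 1)) (at (snd \<kappa> p))" for \<rho>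
    using p by (intro frechet_derivative_transform_within_open[OF
          smooth_fieldD[OF smooth_field_partial_deriv[OF X] p] open_coords])
      (auto simp: partial_deriv_def f'_def f_def comp_def)
  then show ?thesis
    using sym by (simp add: partial_deriv_def[of _ _ "partial_deriv _ _ _"] comp_def)
qed

text \<open>The product rule separates a first-order part, in which the coefficients of
  \<open>b\<close> are differentiated, from a second-order part that cancels in the
  commutator.\<close>

lemma dir_deriv_dir_deriv:
  assumes a: "smooth_field a" and b: "smooth_field b" and X: "smooth_field X" and p: "p \<in> U"
  shows "dir_deriv \<kappa> a (dir_deriv \<kappa> b X) p = dir_deriv \<kappa> (dir_deriv \<kappa> a b) X p
    + (\<Sum>\<mu>\<in>UNIV. \<Sum>\<nu>\<in>UNIV. ((a p \<bullet> axis \<mu> 1) * (b p \<bullet> axis \<nu> 1)) *\<^sub>R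
        partial_deriv \<kappa> \<mu> (partial_deriv \<kappa> \<nu> X) p)"
proof -
  note D = smooth_field_has_derivative[OF _ p]
  have "((\<lambda>x. dir_deriv \<kappa> b X (chart_inv \<kappa> x)) has_derivative
      (\<lambda>h. \<Sum>\<nu>\<in>UNIV. (b p \<bullet> axis \<nu> 1) *\<^sub>R
          frechet_derivative (\<lambda>x. partial_deriv \<kappa> \<nu> X (chart_inv \<kappa> x)) (at (snd \<kappa> p)) h
        + (frechet_derivative (\<lambda>x. b (chart_inv \<kappa> x)) (at (snd \<kappa> p)) h \<bullet> axis \<nu> 1) *\<^sub>R
          partial_deriv \<kappa> \<nu> X p)) (at (snd \<kappa> p))"
    unfolding dir_deriv_def
  proof (rule has_derivative_sum)
    fix \<nu> :: 'n
    show "((\<lambda>x. (b (chart_inv \<kappa> x) \<bullet> axis \<nu> 1) *\<^sub>R partial_deriv \<kappa> \<nu> X (chart_inv \<kappa> x)) has_derivative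
        (\<lambda>h. (b p \<bullet> axis \<nu> 1) *\<^sub>R
            frechet_derivative (\<lambda>x. partial_deriv \<kappa> \<nu> X (chart_inv \<kappa> x)) (at (snd \<kappa> p)) h
          + (frechet_derivative (\<lambda>x. b (chart_inv \<kappa> x)) (at (snd \<kappa> p)) h \<bullet> axis \<nu> 1) *\<^sub>R
            partial_deriv \<kappa> \<nu> X p)) (at (snd \<kappa> p))"
      using has_derivative_scaleR[OF has_derivative_inner_left[OF D[OF b]]
          D[OF smooth_field_partial_deriv[OF X]]] p by simp
  qed
  from dir_deriv_eqI[OF smooth_field_dir_deriv[OF b X] p this]
  have "dir_deriv \<kappa> a (dir_deriv \<kappa> b X) p =
      (\<Sum>\<nu>\<in>UNIV. (b p \<bullet> axis \<nu> 1) *\<^sub>R dir_deriv \<kappa> a (partial_deriv \<kappa> \<nu> X) p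
        + (dir_deriv \<kappa> a b p \<bullet> axis \<nu> 1) *\<^sub>R partial_deriv \<kappa> \<nu> X p)"
    using p by (simp add: dir_deriv_eq[OF b] dir_deriv_eq[OF smooth_field_partial_deriv[OF X]])
  also have "\<dots> = dir_deriv \<kappa> (dir_deriv \<kappa> a b) X p
      + (\<Sum>\<nu>\<in>UNIV. (b p \<bullet> axis \<nu> 1) *\<^sub>R dir_deriv \<kappa> a (partial_deriv \<kappa> \<nu> X) p)"
    by (simp add: sum.distrib dir_deriv_def[of _ _ X])
  also have "(\<Sum>\<nu>\<in>UNIV. (b p \<bullet> axis \<nu> 1) *\<^sub>R dir_deriv \<kappa> a (partial_deriv \<kappa> \<nu> X) p) =
      (\<Sum>\<nu>\<in>UNIV. \<Sum>\<mu>\<in>UNIV. ((a p \<bullet> axis \<mu> 1) * (b p \<bullet> axis \<nu> 1)) *\<^sub>R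
        partial_deriv \<kappa> \<mu> (partial_deriv \<kappa> \<nu> X) p)"
    by (simp add: dir_deriv_def scaleR_sum_right mult.commute)
  finally show ?thesis by (subst sum.swap) simp
qed

text \<open>Exchanging summation indices and commuting partial derivatives identifies the two
  second-order parts; the first-order parts leave the derivative along the bracket.\<close>

lemma dir_deriv_commutator:
  fixes X :: "'m \<Rightarrow> 'b::euclidean_space"
  assumes a: "smooth_field a" and b: "smooth_field b" and X: "smooth_field X" and p: "p \<in> U"
  shows "dir_deriv \<kappa> a (dir_deriv \<kappa> b X) p - dir_deriv \<kappa> b (dir_deriv \<kappa> a X) p =
    dir_deriv \<kappa> (lie_bracket \<kappa> a b) X p"
proof -
  have "(\<Sum>\<mu>\<in>UNIV. \<Sum>\<nu>\<in>UNIV. ((a p \<bullet> axis \<mu> 1) * (b p \<bullet> axis \<nu> 1)) *\<^sub>R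
        partial_deriv \<kappa> \<mu> (partial_deriv \<kappa> \<nu> X) p) =
      (\<Sum>\<mu>\<in>UNIV. \<Sum>\<nu>\<in>UNIV. ((b p \<bullet> axis \<mu> 1) * (a p \<bullet> axis \<nu> 1)) *\<^sub>R
        partial_deriv \<kappa> \<mu> (partial_deriv \<kappa> \<nu> X) p)"
    by (subst sum.swap) (simp add: mult.commute partial_deriv_commute[OF X p])
  then show ?thesis
    unfolding dir_deriv_dir_deriv[OF a b X p] dir_deriv_dir_deriv[OF b a X p]
    by (simp add: lie_bracket_def[abs_def] dir_deriv_diff_left)
qed

lemma smooth_field_lie_bracket:
  "smooth_field a \<Longrightarrow> smooth_field b \<Longrightarrow> smooth_field (lie_bracket \<kappa> a b)"
  unfolding lie_bracket_def[abs_def] by (intro smooth_field_diff smooth_field_dir_deriv)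

lemma lie_bracket_jacobi:
  assumes a: "smooth_field a" and b: "smooth_field b" and d: "smooth_field d" and p: "p \<in> U"
  shows "lie_bracket \<kappa> (lie_bracket \<kappa> a b) d p + lie_bracket \<kappa> (lie_bracket \<kappa> b d) a p
    + lie_bracket \<kappa> (lie_bracket \<kappa> d a) b p = 0"
proof -
  \<comment> \<open>By \<open>dir_deriv_commutator\<close> each double bracket becomes four iterated
    derivatives; in the cyclic sum all twelve cancel in pairs.\<close>
  have "lie_bracket \<kappa> (lie_bracket \<kappa> x y) z p =
      dir_deriv \<kappa> x (dir_deriv \<kappa> y z) p - dir_deriv \<kappa> y (dir_deriv \<kappa> x z) p
      - (dir_deriv \<kappa> z (dir_deriv \<kappa> x y) p - dir_deriv \<kappa> z (dir_deriv \<kappa> y x) p)"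
    if "smooth_field x" "smooth_field y" "smooth_field z" for x y z
  proof -
    have "lie_bracket \<kappa> x y = (\<lambda>q. dir_deriv \<kappa> x y q - dir_deriv \<kappa> y x q)"
      by (simp add: fun_eq_iff lie_bracket_def)
    then have "dir_deriv \<kappa> z (lie_bracket \<kappa> x y) p =
        dir_deriv \<kappa> z (dir_deriv \<kappa> x y) p - dir_deriv \<kappa> z (dir_deriv \<kappa> y x) p"
      using that p by (simp add: dir_deriv_diff_right smooth_field_dir_deriv)
    then show ?thesis
      using that p by (simp add: lie_bracket_def[of _ "lie_bracket _ _ _"] dir_deriv_commutator)
  qed
  then show ?thesis using a b d by simp
qed

end


section \<open>The covariant derivative\<close>

locale smooth_connection = chart_region \<kappa> U
  for \<kappa> :: "('m::topological_space, 'n::finite) chart" and U :: "'m set" +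
  fixes \<gamma> :: "('m, 'n) connection"
  assumes smooth_connection: "smooth_field \<gamma>"
begin

lemma smooth_field_cov_plus:
  "smooth_field a \<Longrightarrow> smooth_field b \<Longrightarrow> smooth_field (cov_plus \<kappa> \<gamma> a b)"
  using smooth_connection unfolding cov_plus_def[abs_def]
  by (intro smooth_field_add smooth_field_dir_deriv)
     (auto simp: smooth_field_def intro!: bounded_bilinear.smooth_on_prod[OF bounded_bilinear_blinfun_apply] open_coords)

lemma smooth_field_curvature:
  "smooth_field a \<Longrightarrow> smooth_field b \<Longrightarrow> smooth_field c \<Longrightarrow> smooth_field (curvature \<kappa> \<gamma> a b c)"
  unfolding curvature_def[abs_def]
  by (intro smooth_field_diff smooth_field_cov_plus smooth_field_lie_bracket)

lemma cov_plus_diff_left: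
  "cov_plus \<kappa> \<gamma> (\<lambda>q. a q - b q) c p = cov_plus \<kappa> \<gamma> a c p - cov_plus \<kappa> \<gamma> b c p"
  by (simp add: cov_plus_def dir_deriv_diff_left blinfun.bilinear_simps)

lemma cov_plus_zero_left: "cov_plus \<kappa> \<gamma> (\<lambda>q. 0) c p = 0"
  by (simp add: cov_plus_def dir_deriv_def)

lemma cov_plus_diff_right:
  assumes "smooth_field b" "smooth_field c" "p \<in> U"
  shows "cov_plus \<kappa> \<gamma> a (\<lambda>q. b q - c q) p = cov_plus \<kappa> \<gamma> a b p - cov_plus \<kappa> \<gamma> a c p"
  using assms by (simp add: cov_plus_def dir_deriv_diff_right blinfun.bilinear_simps)

lemma cov_plus_cong:
  assumes "smooth_field b" "\<And>q. q \<in> U \<Longrightarrow> b q = b' q" "a p = a' p" "p \<in> U"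
  shows "cov_plus \<kappa> \<gamma> a b p = cov_plus \<kappa> \<gamma> a' b' p"
  using assms by (simp add: cov_plus_def dir_deriv_cong[of b b' a p a'])

text \<open>The covariant derivative is tensorial in its direction, so identities of directions
  valid at one point can be substituted.\<close>

lemma cov_plus_cong_left: "a p = a' p \<Longrightarrow> cov_plus \<kappa> \<gamma> a b p = cov_plus \<kappa> \<gamma> a' b p"
  by (simp add: cov_plus_def dir_deriv_def)

lemma curvature_diff_left:
  assumes "smooth_field a" "smooth_field a'" "smooth_field b" "smooth_field c" "p \<in> U"
  shows "curvature \<kappa> \<gamma> (\<lambda>q. a q - a' q) b c p = curvature \<kappa> \<gamma> a b c p - curvature \<kappa> \<gamma> a' b c p"
proof -
  \<comment> \<open>Additivity of the bracket is established at \<open>p\<close> alone, which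
    suffices for a direction. The next fact concerns a field that gets differentiated and is an
    equality of functions.\<close>
  have "cov_plus \<kappa> \<gamma> (lie_bracket \<kappa> (\<lambda>q. a q - a' q) b) c p =
      cov_plus \<kappa> \<gamma> (\<lambda>q. lie_bracket \<kappa> a b q - lie_bracket \<kappa> a' b q) c p"
    using assms by (intro cov_plus_cong_left)
      (simp add: lie_bracket_def dir_deriv_diff_left dir_deriv_diff_right)
  moreover have "cov_plus \<kappa> \<gamma> (\<lambda>q. a q - a' q) c =
      (\<lambda>q. cov_plus \<kappa> \<gamma> a c q - cov_plus \<kappa> \<gamma> a' c q)"
    by (simp add: fun_eq_iff cov_plus_diff_left)
  ultimately show ?thesis
    using assms by (simp add: curvature_def cov_plus_diff_left cov_plus_diff_right smooth_field_cov_plus)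
qed

text \<open>Serves to insert the torsion-free identity, which holds only on \<open>U\<close>, into
  the first argument of the curvature.\<close>

lemma curvature_cong_left:
  assumes "smooth_field a" "smooth_field b" "smooth_field c" "p \<in> U"
    and eq: "\<And>q. q \<in> U \<Longrightarrow> a q = a' q"
  shows "curvature \<kappa> \<gamma> a b c p = curvature \<kappa> \<gamma> a' b c p"
proof -
  have "cov_plus \<kappa> \<gamma> b (cov_plus \<kappa> \<gamma> a c) p = cov_plus \<kappa> \<gamma> b (cov_plus \<kappa> \<gamma> a' c) p"
    using assms by (intro cov_plus_cong smooth_field_cov_plus cov_plus_cong_left) auto
  moreover have "lie_bracket \<kappa> a b p = lie_bracket \<kappa> a' b p"
    unfolding lie_bracket_def using assms dir_deriv_cong[of a a' b p b] dir_deriv_cong[of b b a p a']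
    by simp
  ultimately show ?thesis
    using assms cov_plus_cong_left[of a p a'] cov_plus_cong_left[of "lie_bracket \<kappa> a b" p]
    by (simp add: curvature_def)
qed

lemma curvature_swap: "curvature \<kappa> \<gamma> b a c p = - curvature \<kappa> \<gamma> a b c p"
proof -
  \<comment> \<open>The negated bracket is written as a difference from the zero field, to which
    \<open>cov_plus_diff_left\<close> and \<open>cov_plus_zero_left\<close> apply.\<close>
  have "cov_plus \<kappa> \<gamma> (lie_bracket \<kappa> b a) c p =
      cov_plus \<kappa> \<gamma> (\<lambda>q. (\<lambda>_. 0) q - lie_bracket \<kappa> a b q) c p"
    by (intro cov_plus_cong_left) (simp add: lie_bracket_def)
  also have "\<dots> = - cov_plus \<kappa> \<gamma> (lie_bracket \<kappa> a b) c p"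
    unfolding cov_plus_diff_left cov_plus_zero_left by simp
  finally show ?thesis by (simp add: curvature_def)
qed

section \<open>Explicit form of the covariant derivative of the curvature\<close>

definition cov_curvature_vector where
  "cov_curvature_vector d a b c p =
     cov_plus \<kappa> \<gamma> d (curvature \<kappa> \<gamma> a b c) p
     - curvature \<kappa> \<gamma> (cov_plus \<kappa> \<gamma> d a) b c p
     - curvature \<kappa> \<gamma> a (cov_plus \<kappa> \<gamma> d b) c p
     - curvature \<kappa> \<gamma> a b (cov_plus \<kappa> \<gamma> d c) p"

lemma cov_curvature_eq:
  assumes fields: "\<And>w. w \<in> vector_fields A U \<Longrightarrow> smooth_field w"
    and abc: "smooth_field a" "smooth_field b" "smooth_field c" and p: "p \<in> U"
  shows "cov_curvature A \<kappa> U \<gamma> d a b c p = cov_curvature_vector d a b c p"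
  unfolding cov_curvature_def
proof (rule the_equality)
  \<comment> \<open>The product rule yields two terms. The one with \<open>w\<close> differentiated
    cancels against \<open>cov_minus\<close>, whose adjoint moves the connection from
    \<open>w\<close> onto the curvature and completes \<open>cov_plus\<close>.\<close>
  have "dir_deriv \<kappa> d (\<lambda>q. curvature \<kappa> \<gamma> a b c q \<bullet> w q) p
      - curvature \<kappa> \<gamma> a b c p \<bullet> cov_minus \<kappa> \<gamma> d w p
      = cov_plus \<kappa> \<gamma> d (curvature \<kappa> \<gamma> a b c) p \<bullet> w p"
    if "w \<in> vector_fields A U" for w
    using dir_deriv_inner[OF smooth_field_curvature[OF abc] fields[OF that] p]
    by (simp add: cov_minus_def cov_plus_def inner_diff_right inner_add_left
        adjoint_works bounded_linear.linear[OF blinfun.bounded_linear_right])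
  then show vector: "\<forall>w\<in>vector_fields A U.
      cov_curvature_vector d a b c p \<bullet> w p =
        dir_deriv \<kappa> d (\<lambda>q. curvature \<kappa> \<gamma> a b c q \<bullet> w q) p
        - curvature \<kappa> \<gamma> (cov_plus \<kappa> \<gamma> d a) b c p \<bullet> w p
        - curvature \<kappa> \<gamma> a (cov_plus \<kappa> \<gamma> d b) c p \<bullet> w p
        - curvature \<kappa> \<gamma> a b (cov_plus \<kappa> \<gamma> d c) p \<bullet> w p
        - curvature \<kappa> \<gamma> a b c p \<bullet> cov_minus \<kappa> \<gamma> d w p"
    by (simp add: cov_curvature_vector_def inner_diff_left algebra_simps)
  fix v
  assume v: "\<forall>w\<in>vector_fields A U.
      v \<bullet> w p =
        dir_deriv \<kappa> d (\<lambda>q. curvature \<kappa> \<gamma> a b c q \<bullet> w q) p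
        - curvature \<kappa> \<gamma> (cov_plus \<kappa> \<gamma> d a) b c p \<bullet> w p
        - curvature \<kappa> \<gamma> a (cov_plus \<kappa> \<gamma> d b) c p \<bullet> w p
        - curvature \<kappa> \<gamma> a b (cov_plus \<kappa> \<gamma> d c) p \<bullet> w p
        - curvature \<kappa> \<gamma> a b c p \<bullet> cov_minus \<kappa> \<gamma> d w p"
  \<comment> \<open>Constant fields realise every vector as \<open>w p\<close>, so the inner
    products determine \<open>v\<close>.\<close>
  have const: "(\<lambda>q. k) \<in> vector_fields A U" for k
    by (simp add: vector_fields_def smooth_map_on_def comp_def smooth_on_const)
  have "v \<bullet> k = cov_curvature_vector d a b c p \<bullet> k" for k
    using bspec[OF v const[of k]] bspec[OF vector const[of k]] by (rule trans[OF _ sym])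
  then show "v = cov_curvature_vector d a b c p"
    by (metis euclidean_eqI)
qed

end

section \<open>Torsion-free connections and the Bianchi identity\<close>

locale torsion_free_connection = smooth_connection +
  assumes symmetric: "symmetric_connection U \<gamma>"
begin

text \<open>By symmetry the two connection terms cancel.\<close>

lemma cov_plus_torsion_free:
  "p \<in> U \<Longrightarrow> cov_plus \<kappa> \<gamma> a b p - cov_plus \<kappa> \<gamma> b a p = lie_bracket \<kappa> a b p"
  using symmetric by (simp add: symmetric_connection_def cov_plus_def lie_bracket_def)

text \<open>The difference is the curvature at \<open>[d,a]\<close> and \<open>b\<close>, given in
  expanded form so that its terms can cancel in the cyclic sum.\<close>

lemma curvature_cov_plus_diff:
  assumes "smooth_field a" "smooth_field b" "smooth_field c" "smooth_field d" "p \<in> U"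
  shows "curvature \<kappa> \<gamma> (cov_plus \<kappa> \<gamma> d a) b c p - curvature \<kappa> \<gamma> (cov_plus \<kappa> \<gamma> a d) b c p =
    cov_plus \<kappa> \<gamma> (lie_bracket \<kappa> d a) (cov_plus \<kappa> \<gamma> b c) p
    - cov_plus \<kappa> \<gamma> b (cov_plus \<kappa> \<gamma> (lie_bracket \<kappa> d a) c) p
    - cov_plus \<kappa> \<gamma> (lie_bracket \<kappa> (lie_bracket \<kappa> d a) b) c p"
proof -
  have "curvature \<kappa> \<gamma> (cov_plus \<kappa> \<gamma> d a) b c p - curvature \<kappa> \<gamma> (cov_plus \<kappa> \<gamma> a d) b c p =
      curvature \<kappa> \<gamma> (\<lambda>q. cov_plus \<kappa> \<gamma> d a q - cov_plus \<kappa> \<gamma> a d q) b c p"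
    using assms by (simp add: curvature_diff_left smooth_field_cov_plus)
  also have "\<dots> = curvature \<kappa> \<gamma> (lie_bracket \<kappa> d a) b c p"
    using assms by (intro curvature_cong_left smooth_field_diff smooth_field_cov_plus cov_plus_torsion_free)
  finally show ?thesis by (simp add: curvature_def)
qed

lemma bianchi:
  assumes a: "smooth_field a" and b: "smooth_field b" and c: "smooth_field c" and d: "smooth_field d"
    and p: "p \<in> U"
  shows "cov_curvature_vector d a b c p + cov_curvature_vector a b d c p
    + cov_curvature_vector b d a c p = 0"
proof -
  note smooth = smooth_field_cov_plus smooth_field_lie_bracket smooth_field_diff
  have curv: "cov_plus \<kappa> \<gamma> z (curvature \<kappa> \<gamma> x y c) p =
      cov_plus \<kappa> \<gamma> z (cov_plus \<kappa> \<gamma> x (cov_plus \<kappa> \<gamma> y c)) p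
      - cov_plus \<kappa> \<gamma> z (cov_plus \<kappa> \<gamma> y (cov_plus \<kappa> \<gamma> x c)) p
      - cov_plus \<kappa> \<gamma> z (cov_plus \<kappa> \<gamma> (lie_bracket \<kappa> x y) c) p"
    if "smooth_field x" "smooth_field y" "smooth_field z" for x y z
    using that c p unfolding curvature_def[abs_def]
    by (simp add: cov_plus_diff_right smooth)
  \<comment> \<open>The Jacobi sum is spelled with differences only, so that
    \<open>cov_plus_diff_left\<close> splits it.\<close>
  have "cov_plus \<kappa> \<gamma> (\<lambda>q. lie_bracket \<kappa> (lie_bracket \<kappa> a b) d q
      - (0 - lie_bracket \<kappa> (lie_bracket \<kappa> b d) a q)
      - (0 - lie_bracket \<kappa> (lie_bracket \<kappa> d a) b q)) c p = cov_plus \<kappa> \<gamma> (\<lambda>q. 0) c p"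
    using lie_bracket_jacobi[OF a b d p] by (intro cov_plus_cong_left) simp
  then have jacobi: "cov_plus \<kappa> \<gamma> (lie_bracket \<kappa> (lie_bracket \<kappa> a b) d) c p
      + cov_plus \<kappa> \<gamma> (lie_bracket \<kappa> (lie_bracket \<kappa> b d) a) c p
      + cov_plus \<kappa> \<gamma> (lie_bracket \<kappa> (lie_bracket \<kappa> d a) b) c p = 0"
    unfolding cov_plus_diff_left cov_plus_zero_left by (simp add: algebra_simps)
  \<comment> \<open>Moves the differentiated field to the first slot, where each term meets its
    partner from another summand: \<rho>(b, \<nabla>_a d) pairs with \<rho>(\<nabla>_d a, b), and
    cyclically.\<close>
  have swap: "curvature \<kappa> \<gamma> a (cov_plus \<kappa> \<gamma> d b) c p = - curvature \<kappa> \<gamma> (cov_plus \<kappa> \<gamma> d b) a c p"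
    "curvature \<kappa> \<gamma> b (cov_plus \<kappa> \<gamma> a d) c p = - curvature \<kappa> \<gamma> (cov_plus \<kappa> \<gamma> a d) b c p"
    "curvature \<kappa> \<gamma> d (cov_plus \<kappa> \<gamma> b a) c p = - curvature \<kappa> \<gamma> (cov_plus \<kappa> \<gamma> b a) d c p"
    by (rule curvature_swap)+
  \<comment> \<open>Restricted to a differentiated third argument, so that the curvature terms
    treated by \<open>curv_diff\<close> stay folded.\<close>
  have outer: "curvature \<kappa> \<gamma> x y (cov_plus \<kappa> \<gamma> z c) p =
      cov_plus \<kappa> \<gamma> x (cov_plus \<kappa> \<gamma> y (cov_plus \<kappa> \<gamma> z c)) p
      - cov_plus \<kappa> \<gamma> y (cov_plus \<kappa> \<gamma> x (cov_plus \<kappa> \<gamma> z c)) p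
      - cov_plus \<kappa> \<gamma> (lie_bracket \<kappa> x y) (cov_plus \<kappa> \<gamma> z c) p" for x y z
    by (simp add: curvature_def)
  note curv_diff = curvature_cov_plus_diff[OF a b c d p] curvature_cov_plus_diff[OF b d c a p]
    curvature_cov_plus_diff[OF d a c b p]
  show ?thesis
    \<comment> \<open>\<open>diff_eq_eq\<close> makes each difference a rewrite rule for its first
      curvature term, leaving the partner to cancel; the Jacobi sum is likewise solved for its first
      term.\<close>
    unfolding cov_curvature_vector_def swap outer curv[OF a b d] curv[OF b d a] curv[OF d a b]
      curv_diff[unfolded diff_eq_eq] jacobi[unfolded add.assoc, THEN eq_neg_iff_add_eq_0[THEN iffD2]]
    by (simp add: algebra_simps)
qed

end

theorem mainTheorem4:
  fixes A :: "('m::{t2_space, second_countable_topology}, 'n::finite) chart set"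
    and \<kappa> :: "('m, 'n) chart"
    and U :: "'m set"
    and \<gamma> :: "('m, 'n) connection"
  assumes "parallelism_structure A \<kappa> U \<gamma>"
    and "symmetric_connection U \<gamma>"
  shows "\<forall>a\<in>vector_fields A U. \<forall>b\<in>vector_fields A U. \<forall>c\<in>vector_fields A U. \<forall>d\<in>vector_fields A U.
    \<forall>p\<in>U. cov_curvature A \<kappa> U \<gamma> d a b c p + cov_curvature A \<kappa> U \<gamma> a b d c p
      + cov_curvature A \<kappa> U \<gamma> b d a c p = 0"
proof -
  have \<kappa>: "\<kappa> \<in> A" and U: "open U" "U \<subseteq> fst \<kappa>" and \<gamma>: "smooth_map_on A U \<gamma>"
    and chart: "is_chart \<kappa>"
    using assms(1) by (auto simp: parallelism_structure_def smooth_manifold_def)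
  interpret chart_region \<kappa> U using chart U by unfold_locales
  \<comment> \<open>The atlas condition is read at the chart \<open>\<kappa>\<close>, where
    \<open>U\<close> lies inside the domain. The value type is left open, to cover both
    \<open>\<gamma>\<close> and vector fields.\<close>
  have smooth: "smooth_field X" if "smooth_map_on A U X" for X :: "'m \<Rightarrow> 'b::real_normed_vector"
    using that \<kappa> U by (auto simp: smooth_map_on_def smooth_field_def comp_def Int_absorb2)
  interpret torsion_free_connection \<kappa> U \<gamma>
    using smooth[OF \<gamma>] assms(2) by unfold_locales
  have fields: "smooth_field w" if "w \<in> vector_fields A U" for w
    using that by (simp add: vector_fields_def smooth)
  show ?thesis
    by (simp add: cov_curvature_eq[OF fields] fields bianchi)
qed

end
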